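(* Let $\mathscr{D}$ be a (locally small, well-powered and well-copowered) category admitting a proper factorisation system $(\mathscr{Q},\mathscr{M})$, and let $\mathscr{C}$ be a full subcategory of $\mathscr{D}$ such that: (i) $\mathscr{C}$ is dense in $\mathscr{D}$, i.e. every $a\in\mathscr{D}$ is the colimit of the canonical diagram given by the forgetful functor $\mathscr{C}\downarrow a\to\mathscr{D}$; (ii) $\mathscr{C}$ has all finite colimits and they are preserved by the inclusion functor $\mathscr{C}\hookrightarrow\mathscr{D}$; (iii) for every composite $a\to b\to c$ in $\mathscr{D}$ of a quotient $a\to b$ followed by an embedding $b\to c$, if $a,c\in\mathscr{C}$ then also $b\in\mathscr{C}$. Then for any two $\mathscr{C}$-separable objects $a,b\in\mathscr{D}$ of finite $\mathscr{C}$-type, \[ a\cong b \iff \hom_{\mathscr{D}}(c,a)\cong\hom_{\mathscr{D}}(c,b)\ \text{ (a bijection of sets) for all } c\in\mathscr{C}. \]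
   Context: A proper factorisation system on $\mathscr{D}$ is a pair $(\mathscr{Q},\mathscr{M})$ of classes of morphisms such that: every morphism $f$ factors as $f=m\circ e$ with $e\in\mathscr{Q}$, $m\in\mathscr{M}$; $\mathscr{Q}$ is exactly the class of morphisms with the left lifting property with respect to all morphisms of $\mathscr{M}$, and $\mathscr{M}$ is exactly the class of morphisms with the right lifting property with respect to all morphisms of $\mathscr{Q}$ (fillers not required to be unique); every morphism in $\mathscr{Q}$ is an epimorphism and every morphism in $\mathscr{M}$ is a monomorphism. Morphisms in $\mathscr{Q}$ are called quotients, those in $\mathscr{M}$ embeddings. An object $a\in\mathscr{D}$ is of finite $\mathscr{C}$-type if the set $\hom_{\mathscr{D}}(c,a)$ is finite for each $c\in\mathscr{C}$. An object of $\mathscr{D}$ is $\mathscr{C}$-separable if it is the colimit (in $\mathscr{D}$) of a directed diagram $J$ in $\mathscr{C}$ such that: (1) the colimit cocone consists of embeddings; (2) for every compatible cocone of embeddings over $J$ (with arbitrary vertex in $\mathscr{D}$), the unique connecting morphism from the colimit to the vertex is also an embedding. *)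

theory Defs
  imports Main "HOL-Library.Equipollence"
begin

section \<open>Categories\<close>

record ('o, 'm) cat =
  obj :: "'o set"
  arr :: "'m set"
  src :: "'m \<Rightarrow> 'o"
  trg :: "'m \<Rightarrow> 'o"
  ident :: "'o \<Rightarrow> 'm"
  cmp :: "'m \<Rightarrow> 'm \<Rightarrow> 'm"  (infixl \<open>\<cdot>\<index>\<close> 70)

definition hom :: "('o, 'm) cat \<Rightarrow> 'o \<Rightarrow> 'o \<Rightarrow> 'm set" where
  "hom D a b = {f \<in> arr D. src D f = a \<and> trg D f = b}"

locale category =
  fixes D :: "('o, 'm) cat" (structure)
  assumes src_obj: "f \<in> arr D \<Longrightarrow> src D f \<in> obj D"
    and trg_obj: "f \<in> arr D \<Longrightarrow> trg D f \<in> obj D"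
    and ident_hom: "a \<in> obj D \<Longrightarrow> ident D a \<in> hom D a a"
    and cmp_hom: "f \<in> hom D a b \<Longrightarrow> g \<in> hom D b c \<Longrightarrow> g \<cdot> f \<in> hom D a c"
    and cmp_ident: "f \<in> hom D a b \<Longrightarrow> f \<cdot> ident D a = f"
    and ident_cmp: "f \<in> hom D a b \<Longrightarrow> ident D b \<cdot> f = f"
    and cmp_assoc: "f \<in> hom D a b \<Longrightarrow> g \<in> hom D b c \<Longrightarrow> h \<in> hom D c d
      \<Longrightarrow> (h \<cdot> g) \<cdot> f = h \<cdot> (g \<cdot> f)"

definition full_subcat :: "('o, 'm) cat \<Rightarrow> 'o set \<Rightarrow> ('o, 'm) cat" where
  "full_subcat D C = D\<lparr>obj := C, arr := {f \<in> arr D. src D f \<in> C \<and> trg D f \<in> C}\<rparr>"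

definition is_mono :: "('o, 'm) cat \<Rightarrow> 'm \<Rightarrow> bool" where
  "is_mono D m \<longleftrightarrow> m \<in> arr D \<and>
     (\<forall>x. \<forall>f \<in> hom D x (src D m). \<forall>g \<in> hom D x (src D m).
        m \<cdot>\<^bsub>D\<^esub> f = m \<cdot>\<^bsub>D\<^esub> g \<longrightarrow> f = g)"

definition is_epi :: "('o, 'm) cat \<Rightarrow> 'm \<Rightarrow> bool" where
  "is_epi D e \<longleftrightarrow> e \<in> arr D \<and>
     (\<forall>x. \<forall>f \<in> hom D (trg D e) x. \<forall>g \<in> hom D (trg D e) x.
        f \<cdot>\<^bsub>D\<^esub> e = g \<cdot>\<^bsub>D\<^esub> e \<longrightarrow> f = g)"

definition is_iso :: "('o, 'm) cat \<Rightarrow> 'm \<Rightarrow> bool" where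
  "is_iso D f \<longleftrightarrow> f \<in> arr D \<and>
     (\<exists>g \<in> hom D (trg D f) (src D f).
        g \<cdot>\<^bsub>D\<^esub> f = ident D (src D f) \<and> f \<cdot>\<^bsub>D\<^esub> g = ident D (trg D f))"

definition isomorphic :: "('o, 'm) cat \<Rightarrow> 'o \<Rightarrow> 'o \<Rightarrow> bool" where
  "isomorphic D a b \<longleftrightarrow> (\<exists>f \<in> hom D a b. is_iso D f)"


section \<open>Size conditions\<close>

text \<open>Smallness is relative to a type \<open>'u\<close> playing the role of the universe: a set is small
  if its cardinality is strictly less than that of \<open>'u\<close>. For \<open>'u\<close> of inaccessible cardinality
  \<open>\<kappa>\<close> these are, up to bijection, the elements of the Grothendieck universe \<open>V\<^sub>\<kappa>\<close>. No closure
  property of \<open>'u\<close> is imposed.\<close>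

definition small :: "'u itself \<Rightarrow> 'a set \<Rightarrow> bool" where
  "small U A \<longleftrightarrow> A \<prec> (UNIV :: 'u set)"

definition locally_small :: "'u itself \<Rightarrow> ('o, 'm) cat \<Rightarrow> bool" where
  "locally_small U D \<longleftrightarrow> (\<forall>a \<in> obj D. \<forall>b \<in> obj D. small U (hom D a b))"

definition monos_into :: "('o, 'm) cat \<Rightarrow> 'o \<Rightarrow> 'm set" where
  "monos_into D a = {m. is_mono D m \<and> trg D m = a}"

definition subobj_rel :: "('o, 'm) cat \<Rightarrow> 'o \<Rightarrow> ('m \<times> 'm) set" where
  "subobj_rel D a = {(m, n). m \<in> monos_into D a \<and> n \<in> monos_into D a \<and>
     (\<exists>h \<in> hom D (src D m) (src D n). is_iso D h \<and> n \<cdot>\<^bsub>D\<^esub> h = m)}"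

definition well_powered :: "'u itself \<Rightarrow> ('o, 'm) cat \<Rightarrow> bool" where
  "well_powered U D \<longleftrightarrow> (\<forall>a \<in> obj D. small U (monos_into D a // subobj_rel D a))"

definition epis_from :: "('o, 'm) cat \<Rightarrow> 'o \<Rightarrow> 'm set" where
  "epis_from D a = {e. is_epi D e \<and> src D e = a}"

definition quotobj_rel :: "('o, 'm) cat \<Rightarrow> 'o \<Rightarrow> ('m \<times> 'm) set" where
  "quotobj_rel D a = {(d, e). d \<in> epis_from D a \<and> e \<in> epis_from D a \<and>
     (\<exists>h \<in> hom D (trg D d) (trg D e). is_iso D h \<and> h \<cdot>\<^bsub>D\<^esub> d = e)}"

definition well_copowered :: "'u itself \<Rightarrow> ('o, 'm) cat \<Rightarrow> bool" where
  "well_copowered U D \<longleftrightarrow> (\<forall>a \<in> obj D. small U (epis_from D a // quotobj_rel D a))"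


section \<open>Proper factorisation systems\<close>

text \<open>\<open>has_lifting D e m\<close>: every commutative square with \<open>e\<close> on the left and \<open>m\<close> on the right
  has a (not necessarily unique) diagonal filler.\<close>

definition has_lifting :: "('o, 'm) cat \<Rightarrow> 'm \<Rightarrow> 'm \<Rightarrow> bool" where
  "has_lifting D e m \<longleftrightarrow>
     (\<forall>u \<in> hom D (src D e) (src D m). \<forall>v \<in> hom D (trg D e) (trg D m).
        m \<cdot>\<^bsub>D\<^esub> u = v \<cdot>\<^bsub>D\<^esub> e \<longrightarrow>
        (\<exists>d \<in> hom D (trg D e) (src D m). d \<cdot>\<^bsub>D\<^esub> e = u \<and> m \<cdot>\<^bsub>D\<^esub> d = v))"

definition proper_factorisation_system :: "('o, 'm) cat \<Rightarrow> 'm set \<Rightarrow> 'm set \<Rightarrow> bool" where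
  "proper_factorisation_system D Q M \<longleftrightarrow>
     (\<forall>f \<in> arr D. \<exists>e \<in> Q. \<exists>m \<in> M. trg D e = src D m \<and> f = m \<cdot>\<^bsub>D\<^esub> e) \<and>
     Q = {e \<in> arr D. \<forall>m \<in> M. has_lifting D e m} \<and>
     M = {m \<in> arr D. \<forall>e \<in> Q. has_lifting D e m} \<and>
     (\<forall>e \<in> Q. is_epi D e) \<and>
     (\<forall>m \<in> M. is_mono D m)"


section \<open>Diagrams and colimits\<close>

record ('i, 'k, 'o, 'm) diagram =
  on_obj :: "'i \<Rightarrow> 'o"
  on_arr :: "'k \<Rightarrow> 'm"

definition is_functor :: "('i, 'k) cat \<Rightarrow> ('o, 'm) cat \<Rightarrow> ('i, 'k, 'o, 'm) diagram \<Rightarrow> bool" where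
  "is_functor J D F \<longleftrightarrow>
     (\<forall>i \<in> obj J. on_obj F i \<in> obj D) \<and>
     (\<forall>u \<in> arr J. on_arr F u \<in> hom D (on_obj F (src J u)) (on_obj F (trg J u))) \<and>
     (\<forall>i \<in> obj J. on_arr F (ident J i) = ident D (on_obj F i)) \<and>
     (\<forall>u \<in> arr J. \<forall>v \<in> arr J. trg J u = src J v \<longrightarrow>
        on_arr F (v \<cdot>\<^bsub>J\<^esub> u) = on_arr F v \<cdot>\<^bsub>D\<^esub> on_arr F u)"

definition is_cocone ::
  "('i, 'k) cat \<Rightarrow> ('o, 'm) cat \<Rightarrow> ('i, 'k, 'o, 'm) diagram \<Rightarrow> 'o \<Rightarrow> ('i \<Rightarrow> 'm) \<Rightarrow> bool" where
  "is_cocone J D F v \<kappa> \<longleftrightarrow>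
     v \<in> obj D \<and>
     (\<forall>i \<in> obj J. \<kappa> i \<in> hom D (on_obj F i) v) \<and>
     (\<forall>u \<in> arr J. \<kappa> (trg J u) \<cdot>\<^bsub>D\<^esub> on_arr F u = \<kappa> (src J u))"

definition is_colimit ::
  "('i, 'k) cat \<Rightarrow> ('o, 'm) cat \<Rightarrow> ('i, 'k, 'o, 'm) diagram \<Rightarrow> 'o \<Rightarrow> ('i \<Rightarrow> 'm) \<Rightarrow> bool" where
  "is_colimit J D F v \<kappa> \<longleftrightarrow>
     is_cocone J D F v \<kappa> \<and>
     (\<forall>v' \<kappa>'. is_cocone J D F v' \<kappa>' \<longrightarrow>
        (\<exists>!h. h \<in> hom D v v' \<and> (\<forall>i \<in> obj J. h \<cdot>\<^bsub>D\<^esub> \<kappa> i = \<kappa>' i)))"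


section \<open>Dense subcategories\<close>

text \<open>The slice \<open>C \<down> a\<close>: an object \<open>(c, f : c \<rightarrow> a)\<close> is represented by the arrow \<open>f\<close> alone, and an
  arrow from \<open>f\<close> to \<open>f'\<close> by a triple \<open>(f, g, f')\<close> with \<open>f' \<cdot> g = f\<close>.\<close>

definition slice :: "('o, 'm) cat \<Rightarrow> 'o set \<Rightarrow> 'o \<Rightarrow> ('m, 'm \<times> 'm \<times> 'm) cat" where
  "slice D C a = (let Ob = {f \<in> arr D. src D f \<in> C \<and> trg D f = a} in
     \<lparr>obj = Ob,
      arr = {(f, g, f'). f \<in> Ob \<and> f' \<in> Ob \<and> g \<in> hom D (src D f) (src D f') \<and> f' \<cdot>\<^bsub>D\<^esub> g = f},
      src = (\<lambda>(f, g, f'). f),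
      trg = (\<lambda>(f, g, f'). f'),
      ident = (\<lambda>f. (f, ident D (src D f), f)),
      cmp = (\<lambda>(f', h, f'') (f, g, _). (f, h \<cdot>\<^bsub>D\<^esub> g, f''))\<rparr>)"

definition slice_forget :: "('o, 'm) cat \<Rightarrow> ('m, 'm \<times> 'm \<times> 'm, 'o, 'm) diagram" where
  "slice_forget D = \<lparr>on_obj = src D, on_arr = (\<lambda>(f, g, f'). g)\<rparr>"

text \<open>The component of the canonical cocone at the object \<open>f : c \<rightarrow> a\<close> of the slice is \<open>f\<close> itself.\<close>

definition dense_in :: "('o, 'm) cat \<Rightarrow> 'o set \<Rightarrow> bool" where
  "dense_in D C \<longleftrightarrow> (\<forall>a \<in> obj D. is_colimit (slice D C a) D (slice_forget D) a (\<lambda>f. f))"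


section \<open>Finite colimits\<close>

text \<open>Every finite category is isomorphic to one whose objects and arrows are natural numbers,
  so it suffices to let such categories be the shapes.\<close>

definition finite_cat :: "('i, 'k) cat \<Rightarrow> bool" where
  "finite_cat J \<longleftrightarrow> category J \<and> finite (obj J) \<and> finite (arr J)"

definition has_finite_colimits :: "('o, 'm) cat \<Rightarrow> bool" where
  "has_finite_colimits E \<longleftrightarrow>
     (\<forall>(J :: (nat, nat) cat) F. finite_cat J \<longrightarrow> is_functor J E F \<longrightarrow> (\<exists>v \<kappa>. is_colimit J E F v \<kappa>))"

definition inclusion_preserves_finite_colimits :: "('o, 'm) cat \<Rightarrow> 'o set \<Rightarrow> bool" where
  "inclusion_preserves_finite_colimits D C \<longleftrightarrow>
     (\<forall>(J :: (nat, nat) cat) F v \<kappa>. finite_cat J \<longrightarrow> is_functor J (full_subcat D C) F \<longrightarrow>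
        is_colimit J (full_subcat D C) F v \<kappa> \<longrightarrow> is_colimit J D F v \<kappa>)"


section \<open>Separable objects and objects of finite type\<close>

definition finite_type :: "('o, 'm) cat \<Rightarrow> 'o set \<Rightarrow> 'o \<Rightarrow> bool" where
  "finite_type D C a \<longleftrightarrow> (\<forall>c \<in> C. finite (hom D c a))"

definition directed_poset :: "'i set \<Rightarrow> ('i \<times> 'i) set \<Rightarrow> bool" where
  "directed_poset I r \<longleftrightarrow> partial_order_on I r \<and> I \<noteq> {} \<and>
     (\<forall>i \<in> I. \<forall>j \<in> I. \<exists>k \<in> I. (i, k) \<in> r \<and> (j, k) \<in> r)"

definition poset_cat :: "'i set \<Rightarrow> ('i \<times> 'i) set \<Rightarrow> ('i, 'i \<times> 'i) cat" where
  "poset_cat I r =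
     \<lparr>obj = I, arr = r, src = fst, trg = snd, ident = (\<lambda>i. (i, i)), cmp = (\<lambda>(_, k) (i, _). (i, k))\<rparr>"

text \<open>Diagrams are small, so up to isomorphism of the shape their index set is a small subset of
  the universe \<open>'u\<close>.\<close>

definition separable ::
  "'u itself \<Rightarrow> ('o, 'm) cat \<Rightarrow> 'o set \<Rightarrow> 'm set \<Rightarrow> 'o \<Rightarrow> bool" where
  "separable U D C M a \<longleftrightarrow>
     (\<exists>(I :: 'u set) r F \<kappa>.
        small U I \<and> directed_poset I r \<and>
        is_functor (poset_cat I r) (full_subcat D C) F \<and>
        is_colimit (poset_cat I r) D F a \<kappa> \<and>
        (\<forall>i \<in> I. \<kappa> i \<in> M) \<and>
        (\<forall>v \<kappa>'. is_cocone (poset_cat I r) D F v \<kappa>' \<and> (\<forall>i \<in> I. \<kappa>' i \<in> M) \<longrightarrow>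
           (\<forall>h \<in> hom D a v. (\<forall>i \<in> I. h \<cdot>\<^bsub>D\<^esub> \<kappa> i = \<kappa>' i) \<longrightarrow> h \<in> M)))"


section \<open>The auxiliary constructions are well formed\<close>

lemma full_subcat_sel [simp]:
  "obj (full_subcat D C) = C"
  "arr (full_subcat D C) = {f \<in> arr D. src D f \<in> C \<and> trg D f \<in> C}"
  "src (full_subcat D C) = src D"
  "trg (full_subcat D C) = trg D"
  "ident (full_subcat D C) = ident D"
  "cmp (full_subcat D C) = cmp D"
  by (simp_all add: full_subcat_def)

lemma full_subcat_category:
  assumes "category D" "C \<subseteq> obj D"
  shows "category (full_subcat D C)"
proof -
  interpret category D by fact
  have h: "f \<in> hom (full_subcat D C) a b \<longleftrightarrow> f \<in> hom D a b \<and> a \<in> C \<and> b \<in> C" for f a b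
    by (auto simp: hom_def)
  show ?thesis
    by unfold_locales
      (use assms(2) in \<open>auto simp: h intro: ident_hom cmp_hom cmp_ident ident_cmp cmp_assoc\<close>)
qed

lemma poset_cat_category:
  assumes "partial_order_on I r"
  shows "category (poset_cat I r)"
  using assms
  by unfold_locales
    (auto simp: poset_cat_def hom_def partial_order_on_def preorder_on_def refl_on_def
      dest: transD)

lemma slice_category:
  assumes "category D" "C \<subseteq> obj D"
  shows "category (slice D C a)"
proof -
  interpret category D by fact
  have h: "t \<in> hom (slice D C a) x y \<longleftrightarrow>
      (\<exists>g. t = (x, g, y) \<and> x \<in> hom D (src D x) a \<and> y \<in> hom D (src D y) a \<and>
        src D x \<in> C \<and> src D y \<in> C \<and> g \<in> hom D (src D x) (src D y) \<and> y \<cdot>\<^bsub>D\<^esub> g = x)" for t x y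
    by (auto simp: slice_def Let_def hom_def)
  have o: "x \<in> obj (slice D C a) \<longleftrightarrow> x \<in> hom D (src D x) a \<and> src D x \<in> C" for x
    by (auto simp: slice_def Let_def hom_def)
  have i: "ident (slice D C a) x = (x, ident D (src D x), x)" for x
    by (simp add: slice_def Let_def)
  have c: "cmp (slice D C a) (y, k, z) (x, g, w) = (x, k \<cdot>\<^bsub>D\<^esub> g, z)" for x y z w g k
    by (simp add: slice_def Let_def)
  show ?thesis
  proof (unfold_locales, goal_cases)
    case (1 t)
    then show ?case by (auto simp: slice_def Let_def)
  next
    case (2 t)
    then show ?case by (auto simp: slice_def Let_def)
  next
    case (3 x)
    then have x: "x \<in> hom D (src D x) a" "src D x \<in> C"
      by (simp_all add: o)
    with assms(2) have "src D x \<in> obj D" by blast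
    with x ident_hom cmp_ident[OF x(1)] show ?case by (simp add: h i)
  next
    case (4 t x y s z)
    then obtain g k where tk: "t = (x, g, y)" "s = (y, k, z)"
      and f: "x \<in> hom D (src D x) a" "z \<in> hom D (src D z) a" "src D x \<in> C" "src D z \<in> C"
        "g \<in> hom D (src D x) (src D y)" "k \<in> hom D (src D y) (src D z)" "z \<cdot>\<^bsub>D\<^esub> k = y" "y \<cdot>\<^bsub>D\<^esub> g = x"
      unfolding h by blast
    have "z \<cdot>\<^bsub>D\<^esub> (k \<cdot>\<^bsub>D\<^esub> g) = x"
      using cmp_assoc[OF f(5,6,2)] f(7,8) by simp
    moreover have "k \<cdot>\<^bsub>D\<^esub> g \<in> hom D (src D x) (src D z)"
      using cmp_hom[OF f(5,6)] .
    ultimately show ?case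
      unfolding tk c h using f(1-4) by blast
  next
    case (5 t x y)
    then obtain g where "t = (x, g, y)" "g \<in> hom D (src D x) (src D y)"
      unfolding h by blast
    then show ?case by (simp add: i c cmp_ident)
  next
    case (6 t x y)
    then obtain g where "t = (x, g, y)" "g \<in> hom D (src D x) (src D y)"
      unfolding h by blast
    then show ?case by (simp add: i c ident_cmp)
  next
    case (7 t x y s z r w)
    then obtain g k l where "t = (x, g, y)" "s = (y, k, z)" "r = (z, l, w)"
      "g \<in> hom D (src D x) (src D y)" "k \<in> hom D (src D y) (src D z)"
      "l \<in> hom D (src D z) (src D w)"
      unfolding h by blast
    then show ?case by (simp add: c cmp_assoc)
  qed
qed

lemma slice_forget_functor:
  assumes "category D" "C \<subseteq> obj D"
  shows "is_functor (slice D C a) D (slice_forget D)"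
  using assms by (auto simp: is_functor_def slice_def slice_forget_def Let_def)

end

(* The solutions in hom(-, v) of a finite system of equations between arrows out of objects of C are
   counted by hom(c, v) for a finite colimit c in C. Hence equal hom counts give a and b equally many
   solutions of every such system and, by inclusion-exclusion, equally many solutions that violate
   a given finite set of further equations. Apply this to the unknowns phi x, one for each arrow
   x : c -> a with c in C, the equations expressing naturality, and the inequations expressing
   injectivity: every finite part is solved in a by phi x = x, hence is solvable in b. As each
   hom(c, b) is finite, Tychonoff's theorem yields a natural injective family hom(c, a) -> hom(c, b).
   By density it is composition with some h : a -> b; by counting it is bijective, and by density
   again h is invertible. *)

theory Submission
  imports Defs "HOL-Analysis.Function_Topology"
begin

section \<open>Compactness for binary constraints on finitely many values per variable\<close>

text \<open>By Tychonoff's theorem the product of the finite discrete spaces \<open>Y v\<close> is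
  compact. A constraint reads only two coordinates, so its solution set is closed, and
  \<open>sat\<close> is the finite intersection property of these sets. Binary constraints suffice
  later: naturality at one arrow and distinctness of two values each involve two unknowns.\<close>

lemma finite_selection_compactness:
  fixes x y :: "'i \<Rightarrow> 'x" and R :: "'i \<Rightarrow> ('y \<times> 'y) set"
  assumes fin: "\<And>v. v \<in> X \<Longrightarrow> finite (Y v)"
    and xy: "\<And>i. i \<in> I \<Longrightarrow> x i \<in> X \<and> y i \<in> X"
    and sat: "\<And>K. finite K \<Longrightarrow> K \<subseteq> I \<Longrightarrow> \<exists>\<phi> \<in> PiE X Y. \<forall>i \<in> K. (\<phi> (x i), \<phi> (y i)) \<in> R i"
  shows "\<exists>\<phi> \<in> PiE X Y. \<forall>i \<in> I. (\<phi> (x i), \<phi> (y i)) \<in> R i"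
\<comment> \<open>An intersection over no constraints would be the whole type instead of the
  product, so this case is treated apart.\<close>
proof (cases "I = {}")
  case True
  then show ?thesis using sat[of "{}"] by auto
next
  case False
  define T where "T = product_topology (\<lambda>v. discrete_topology (Y v)) X"
  have top: "topspace T = PiE X Y" by (simp add: T_def)
  have comp: "compact_space T"
    unfolding T_def using fin by (simp add: compact_space_product_topology compact_space_discrete_topology)
  define S where "S i = {\<phi> \<in> PiE X Y. (\<phi> (x i), \<phi> (y i)) \<in> R i}" for i
  have point: "closedin T {\<phi> \<in> PiE X Y. \<phi> v = u}" if "v \<in> X" "u \<in> Y v" for v u
  proof -
    have "continuous_map T (discrete_topology (Y v)) (\<lambda>\<phi>. \<phi> v)"
      unfolding T_def by (rule continuous_map_product_projection[OF that(1)])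
    then have "closedin T {\<phi> \<in> topspace T. \<phi> v \<in> {u}}"
      by (rule closedin_continuous_map_preimage) (use that in auto)
    then show ?thesis by (simp add: top)
  qed
  have closed: "closedin T (S i)" if i: "i \<in> I" for i
  proof -
    \<comment> \<open>A union over the admissible pairs of values. There are finitely many of them,
      and each contributes the intersection of two preimages of points.\<close>
    have eq: "S i = (\<Union>(u, v) \<in> R i \<inter> Y (x i) \<times> Y (y i).
        {\<phi> \<in> PiE X Y. \<phi> (x i) = u} \<inter> {\<phi> \<in> PiE X Y. \<phi> (y i) = v})"
      using xy[OF i] by (auto simp: S_def)
    have "finite (R i \<inter> Y (x i) \<times> Y (y i))"
      using xy[OF i] fin by auto
    then show ?thesis
      unfolding eq using xy[OF i] by (intro closedin_Union) (auto intro!: closedin_Int point)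
  qed
  have "\<Inter>(S ` I) \<noteq> {}"
  proof (rule compact_space_fip[THEN iffD1, OF comp, rule_format], intro conjI ballI allI impI)
    fix C assume "C \<in> S ` I" then show "closedin T C" using closed by blast
  next
    fix \<F> assume "finite \<F> \<and> \<F> \<subseteq> S ` I"
    then obtain K where K: "finite K" "K \<subseteq> I" "\<F> = S ` K"
      by (meson finite_subset_image)
    from sat[OF K(1,2)] show "\<Inter>\<F> \<noteq> {}"
      unfolding K(3) S_def by blast
  qed
  with False show ?thesis unfolding S_def by blast
qed

section \<open>Inclusion-exclusion as a transfer of cardinalities\<close>

lemma card_none_insert:
  assumes "finite W"
  shows "card {u \<in> W. \<forall>p \<in> insert q N. \<not> E p u} =
    card {u \<in> W. \<forall>p \<in> N. \<not> E p u} - card {u \<in> {u \<in> W. E q u}. \<forall>p \<in> N. \<not> E p u}"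
proof -
  have "{u \<in> W. \<forall>p \<in> insert q N. \<not> E p u} =
    {u \<in> W. \<forall>p \<in> N. \<not> E p u} - {u \<in> {u \<in> W. E q u}. \<forall>p \<in> N. \<not> E p u}" by auto
  then show ?thesis using assms by (simp only:) (rule card_Diff_subset; auto)
qed

text \<open>Inclusion-exclusion expresses the number of elements violating all conditions in
  \<open>N\<close> by the numbers of those satisfying all conditions in \<open>P\<close>, for
  \<open>P\<close> \<subseteq> \<open>N\<close>. The induction avoids the alternating sum: it splits
  off one condition \<open>q\<close> and subtracts the elements that satisfy \<open>q\<close> but
  violate the rest.\<close>

lemma card_none_eq_if_card_all_eq:
  assumes "finite N" "finite U" "finite V"
    and "\<And>P. P \<subseteq> N \<Longrightarrow> card {u \<in> U. \<forall>p \<in> P. A p u} = card {v \<in> V. \<forall>p \<in> P. B p v}"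
  shows "card {u \<in> U. \<forall>p \<in> N. \<not> A p u} = card {v \<in> V. \<forall>p \<in> N. \<not> B p v}"
  using assms
proof (induction N arbitrary: U V rule: finite_induct)
  case empty
  from empty.prems(3)[of "{}"] show ?case by simp
next
  case (insert q N)
  have 1: "card {u \<in> U. \<forall>p \<in> N. \<not> A p u} = card {v \<in> V. \<forall>p \<in> N. \<not> B p v}"
    by (rule insert.IH) (use insert.prems in auto)
  \<comment> \<open>Here the induction hypothesis is applied to the elements satisfying the
    condition at \<open>q\<close>, which is why \<open>U\<close> and \<open>V\<close> are arbitrary.
    Its premise for \<open>P\<close> is the given one for \<open>insert q P\<close>.\<close>
  have 2: "card {u \<in> {u \<in> U. A q u}. \<forall>p \<in> N. \<not> A p u} = card {v \<in> {v \<in> V. B q v}. \<forall>p \<in> N. \<not> B p v}"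
  proof (rule insert.IH)
    fix P assume "P \<subseteq> N"
    then have "card {u \<in> U. \<forall>p \<in> insert q P. A p u} = card {v \<in> V. \<forall>p \<in> insert q P. B p v}"
      by (intro insert.prems(3)) auto
    moreover have "{u \<in> U. \<forall>p \<in> insert q P. A p u} = {u \<in> {u \<in> U. A q u}. \<forall>p \<in> P. A p u}"
      "{v \<in> V. \<forall>p \<in> insert q P. B p v} = {v \<in> {v \<in> V. B q v}. \<forall>p \<in> P. B p v}" by auto
    ultimately show "card {u \<in> {u \<in> U. A q u}. \<forall>p \<in> P. A p u} = card {v \<in> {v \<in> V. B q v}. \<forall>p \<in> P. B p v}" by simp
  qed (use insert.prems in auto)
  show ?case unfolding card_none_insert[OF insert.prems(1)] card_none_insert[OF insert.prems(2)] 1 2 ..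
qed

section \<open>Finite systems of equations and the colimits representing their solutions\<close>

lemma homD: "f \<in> hom D a b \<Longrightarrow> f \<in> arr D \<and> src D f = a \<and> trg D f = b"
  by (simp add: hom_def)

text \<open>The unknown at \<open>x\<close> is an arrow from \<open>d x\<close> to \<open>v\<close>.
  \<open>PiE\<close> fixes the values outside \<open>X\<close>, so that solutions can be
  counted.\<close>

definition solutions ::
  "('o, 'm) cat \<Rightarrow> 'x set \<Rightarrow> ('x \<Rightarrow> 'o) \<Rightarrow> ('x \<times> 'm \<times> 'x \<times> 'm) set \<Rightarrow> 'o \<Rightarrow> ('x \<Rightarrow> 'm) set" where
  "solutions D X d E v =
     {\<phi> \<in> PiE X (\<lambda>x. hom D (d x) v). \<forall>(x, f, y, g) \<in> E. \<phi> x \<cdot>\<^bsub>D\<^esub> f = \<phi> y \<cdot>\<^bsub>D\<^esub> g}"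

context
  fixes n k :: nat and l r :: "nat \<Rightarrow> nat"
begin

text \<open>The objects below \<open>n\<close> are variables, the next \<open>k\<close> are equations; the arrows below \<open>n + k\<close> are
  the identities, followed by the \<open>k\<close> left legs \<open>n + j \<rightarrow> l j\<close> and the \<open>k\<close> right legs \<open>n + j \<rightarrow> r j\<close>.
  No two non-identity arrows are composable.\<close>

definition system_shape :: "(nat, nat) cat" where
  "system_shape =
     \<lparr>obj = {..<n + k}, arr = {..<n + k + k + k},
      src = (\<lambda>t. if t < n + k then t else if t < n + k + k then t - k else t - k - k),
      trg = (\<lambda>t. if t < n + k then t else if t < n + k + k then l (t - (n + k)) else r (t - (n + k + k))),
      ident = (\<lambda>i. i),
      cmp = (\<lambda>h g. if g < n + k then h else g)\<rparr>"

lemma system_shape_sel [simp]: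
  "obj system_shape = {..<n + k}"
  "arr system_shape = {..<n + k + k + k}"
  "src system_shape t = (if t < n + k then t else if t < n + k + k then t - k else t - k - k)"
  "trg system_shape t =
     (if t < n + k then t else if t < n + k + k then l (t - (n + k)) else r (t - (n + k + k)))"
  "ident system_shape i = i"
  "h \<cdot>\<^bsub>system_shape\<^esub> g = (if g < n + k then h else g)"
  by (simp_all add: system_shape_def)

lemma system_shape_arr_cases:
  assumes "t < n + k + k + k"
  obtains "t < n + k" | j where "t = n + k + j" "j < k" | j where "t = n + k + k + j" "j < k"
proof -
  consider "t < n + k" | "n + k \<le> t" "t < n + k + k" | "n + k + k \<le> t" by linarith
  then show ?thesis
  proof cases
    case 2 then show ?thesis using that(2)[of "t - (n + k)"] by simp
  next
    case 3 then show ?thesis using that(3)[of "t - (n + k + k)"] assms by simp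
  qed (rule that(1))
qed

lemma system_shape_finite_cat:
  assumes lr: "\<And>j. j < k \<Longrightarrow> l j < n \<and> r j < n"
  shows "finite_cat system_shape"
proof -
  have l: "l (t - (n + k)) < n" if "t < n + k + k" "\<not> t < n + k" for t
    using lr[of "t - (n + k)"] that by simp
  have r: "r (t - (n + k + k)) < n" if "t < n + k + k + k" "\<not> t < n + k + k" for t
    using lr[of "t - (n + k + k)"] that by simp
  have tr: "trg system_shape t < n" if "t < n + k + k + k" "\<not> t < n + k" for t
    using that l[of t] r[of t] by simp
  have s: "n \<le> src system_shape t" if "\<not> t < n + k" for t
    using that by auto
  \<comment> \<open>A leg ends at a variable but starts at an equation object, so whatever follows a
    leg is an identity.\<close>
  have id: "h < n + k" if "h \<in> arr system_shape" "\<not> g < n + k" "g \<in> arr system_shape"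
     "trg system_shape g = src system_shape h" for g h
    using s[of h] tr[of g] that by (metis lessThan_iff not_less system_shape_sel(2))
  have "category system_shape"
  proof (unfold_locales, goal_cases)
    case (1 f) then show ?case by auto
  next
    case (2 f) then show ?case using tr[of f] by (cases "f < n + k") auto
  next
    case (3 i) then show ?case by (simp add: hom_def)
  next
    case (4 f a b g c)
    show ?case
    proof (cases "f < n + k")
      case True
      then show ?thesis using 4 by (simp add: hom_def)
    next
      case False
      then have "g < n + k" using id[of g f] homD[OF 4(1)] homD[OF 4(2)] by metis
      then show ?thesis using 4 False by (simp add: hom_def)
    qed
  next
    case (5 f a b)
    then have "a < n + k" by (auto simp: hom_def split: if_splits)
    then show ?case by simp
  next
    case (6 f a b)
    then show ?case by (auto simp: hom_def split: if_splits)
  next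
    case (7 f a b g c h d)
    then show ?case by simp
  qed
  then show ?thesis by (simp add: finite_cat_def)
qed

end

text \<open>The object \<open>c\<close> is the colimit of the diagram with \<open>d i\<close> at the
  variables, \<open>e j\<close> at the equation objects and \<open>f j\<close>, \<open>g j\<close>
  as legs. A cocone with vertex \<open>v\<close> is determined by its components at the variables,
  and such components extend to a cocone exactly when they solve the system: the component at
  equation \<open>j\<close> must be the common value of both sides.\<close>

lemma solutions_representable_nat:
  fixes D :: "('o, 'm) cat" and d e :: "nat \<Rightarrow> 'o" and n k :: nat and l r :: "nat \<Rightarrow> nat"
  assumes cat: "category D" and CD: "C \<subseteq> obj D"
    and colim: "has_finite_colimits (full_subcat D C)"
    and pres: "inclusion_preserves_finite_colimits D C"
    and d: "\<And>i. i < n \<Longrightarrow> d i \<in> C"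
    and e: "\<And>j. j < k \<Longrightarrow> e j \<in> C"
    and lr: "\<And>j. j < k \<Longrightarrow> l j < n \<and> r j < n"
    and f: "\<And>j. j < k \<Longrightarrow> f j \<in> hom D (e j) (d (l j))"
    and g: "\<And>j. j < k \<Longrightarrow> g j \<in> hom D (e j) (d (r j))"
  shows "\<exists>c \<in> C. \<forall>v \<in> obj D.
    hom D c v \<approx> solutions D {..<n} d ((\<lambda>j. (l j, f j, r j, g j)) ` {..<k}) v"
proof -
  interpret category D by fact
  let ?J = "system_shape n k l r"
  define F where "F = \<lparr>on_obj = (\<lambda>i. if i < n then d i else e (i - n)),
    on_arr = (\<lambda>t. if t < n + k then ident D (if t < n then d t else e (t - n))
      else if t < n + k + k then f (t - (n + k)) else g (t - (n + k + k)))\<rparr>"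
  have Fo: "on_obj F i = (if i < n then d i else e (i - n))" for i by (simp add: F_def)
  have Fa: "on_arr F t = (if t < n + k then ident D (on_obj F t)
      else if t < n + k + k then f (t - (n + k)) else g (t - (n + k + k)))" for t by (simp add: F_def)
  have FoC: "on_obj F i \<in> C" if "i < n + k" for i using that d e by (simp add: Fo)
  have fcat: "finite_cat ?J" by (rule system_shape_finite_cat) (rule lr)
  have Fhom: "on_arr F t \<in> hom D (on_obj F (src ?J t)) (on_obj F (trg ?J t))"
    if t: "t < n + k + k + k" for t
  proof -
    from t consider "t < n + k" | j where "t = n + k + j" "j < k" | j where "t = n + k + k + j" "j < k"
      by (rule system_shape_arr_cases)
    then show ?thesis
    proof cases
      case 1
      then show ?thesis using FoC[OF 1] CD by (auto simp: Fa intro: ident_hom)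
    next
      case 2
      then show ?thesis using f[of j] lr[of j] by (simp add: Fa Fo)
    next
      case 3
      then show ?thesis using g[of j] lr[of j] by (simp add: Fa Fo)
    qed
  qed
  have trg_less: "trg ?J t < n + k" if "t < n + k + k + k" for t
    using fcat that unfolding finite_cat_def by (metis category.trg_obj lessThan_iff system_shape_sel(1,2))
  have src_less: "src ?J t < n + k" if "t < n + k + k + k" for t
    using fcat that unfolding finite_cat_def by (metis category.src_obj lessThan_iff system_shape_sel(1,2))
  have sub_hom: "t \<in> hom (full_subcat D C) x y" if "t \<in> hom D x y" "x \<in> C" "y \<in> C" for t x y
    using that by (simp add: hom_def)
  have func: "is_functor ?J (full_subcat D C) F"
    unfolding is_functor_def
  proof (intro conjI ballI impI, goal_cases)
    case (1 i) then show ?case using FoC by simp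
  next
    case (2 t)
    then have t: "t < n + k + k + k" by simp
    show ?case by (rule sub_hom[OF Fhom[OF t] FoC[OF src_less[OF t]] FoC[OF trg_less[OF t]]])
  next
    case (3 i) then show ?case by (simp add: Fa)
  next
    case (4 u v)
    then have u: "u < n + k + k + k" and v: "v < n + k + k + k" by simp_all
    note hu = Fhom[OF u] and hv = Fhom[OF v]
    show ?case
    proof (cases "u < n + k")
      case True
      then have "on_arr F u = ident D (on_obj F (src ?J v))" using 4 by (simp add: Fa)
      then show ?thesis using True cmp_ident[OF hv] by simp
    next
      case False
      \<comment> \<open>The arrow \<open>u\<close> is a leg, so it ends at a variable. No leg starts
        there, hence \<open>v\<close> is an identity.\<close>
      have "trg ?J u < n"
        using lr[of "u - (n + k)"] lr[of "u - (n + k + k)"] False u by auto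
      then have "v < n + k" using 4(3) by (auto split: if_splits)
      then have "on_arr F v = ident D (on_obj F (trg ?J u))" using 4 by (simp add: Fa)
      then show ?thesis using False ident_cmp[OF hu] by simp
    qed
  qed
  obtain c \<kappa> where col: "is_colimit ?J (full_subcat D C) F c \<kappa>"
    using colim fcat func unfolding has_finite_colimits_def by blast
  have cC: "c \<in> C" using col by (simp add: is_colimit_def is_cocone_def)
  \<comment> \<open>The colimit is formed in \<open>C\<close>, but vertices anywhere in
    \<open>D\<close> are needed; preservation extends the universal property to them.\<close>
  have colD: "is_colimit ?J D F c \<kappa>"
    using pres fcat func col unfolding inclusion_preserves_finite_colimits_def by blast
  then have coc: "is_cocone ?J D F c \<kappa>" by (simp add: is_colimit_def)
  have \<kappa>: "\<kappa> i \<in> hom D (on_obj F i) c" if "i < n + k" for i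
    using coc that by (simp add: is_cocone_def)
  have \<kappa>v: "\<kappa> i \<in> hom D (d i) c" if "i < n" for i
    using \<kappa>[of i] that by (simp add: Fo)
  have leg: "\<kappa> (trg ?J t) \<cdot>\<^bsub>D\<^esub> on_arr F t = \<kappa> (src ?J t)" if "t < n + k + k + k" for t
    using coc that unfolding is_cocone_def by (metis lessThan_iff system_shape_sel(2))
  have legl: "\<kappa> (l j) \<cdot>\<^bsub>D\<^esub> f j = \<kappa> (n + j)" and legr: "\<kappa> (r j) \<cdot>\<^bsub>D\<^esub> g j = \<kappa> (n + j)" if "j < k" for j
    using leg[of "n + k + j"] leg[of "n + k + k + j"] that by (simp_all add: Fa)
  define S where "S v = solutions D {..<n} d ((\<lambda>j. (l j, f j, r j, g j)) ` {..<k}) v" for v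
  have S: "\<phi> \<in> S v \<longleftrightarrow> \<phi> \<in> PiE {..<n} (\<lambda>i. hom D (d i) v) \<and>
    (\<forall>j < k. \<phi> (l j) \<cdot>\<^bsub>D\<^esub> f j = \<phi> (r j) \<cdot>\<^bsub>D\<^esub> g j)" for \<phi> v
    by (auto simp: S_def solutions_def)
  have "hom D c v \<approx> S v" if v: "v \<in> obj D" for v
  proof -
    let ?G = "\<lambda>h. \<lambda>i \<in> {..<n}. h \<cdot>\<^bsub>D\<^esub> \<kappa> i"
    have ex1: "\<exists>!h. h \<in> hom D c v \<and> (\<forall>i < n. h \<cdot>\<^bsub>D\<^esub> \<kappa> i = \<phi> i)" if \<phi>: "\<phi> \<in> S v" for \<phi>
    proof -
      \<comment> \<open>The solution is extended to the equation objects along the left legs; that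
        the right legs give the same values is the system itself.\<close>
      define \<psi> where "\<psi> i = (if i < n then \<phi> i else \<phi> (l (i - n)) \<cdot>\<^bsub>D\<^esub> f (i - n))" for i
      have \<phi>h: "\<phi> i \<in> hom D (d i) v" if "i < n" for i using \<phi> that by (auto simp: S)
      have \<psi>h: "\<psi> i \<in> hom D (on_obj F i) v" if "i < n + k" for i
      proof (cases "i < n")
        case False
        then show ?thesis
          using that lr[of "i - n"] by (simp add: \<psi>_def Fo) (rule cmp_hom[OF f \<phi>h]; simp)
      qed (simp add: \<psi>_def Fo \<phi>h)
      have "is_cocone ?J D F v \<psi>"
        unfolding is_cocone_def
      proof (intro conjI ballI, goal_cases)
        case 1 show ?case by (rule v)
      next
        case (2 i) then show ?case using \<psi>h by simp
      next
        case (3 t)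
        then have "t < n + k + k + k" by simp
        then consider "t < n + k" | j where "t = n + k + j" "j < k" | j where "t = n + k + k + j" "j < k"
          by (rule system_shape_arr_cases)
        then show ?case
        proof cases
          case 1
          then show ?thesis using cmp_ident[OF \<psi>h[OF 1]] by (simp add: Fa)
        next
          case 2
          then show ?thesis using lr[of j] by (simp add: Fa \<psi>_def)
        next
          case 3
          then show ?thesis using lr[of j] \<phi> by (simp add: Fa \<psi>_def S)
        qed
      qed
      then have *: "\<exists>!h. h \<in> hom D c v \<and> (\<forall>i < n + k. h \<cdot>\<^bsub>D\<^esub> \<kappa> i = \<psi> i)"
        using colD unfolding is_colimit_def by (metis lessThan_iff system_shape_sel(1))
      \<comment> \<open>The conditions at the equation objects follow from those at the variables,
        since each \<kappa> component there factors through a left leg.\<close>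
      have "(\<forall>i < n + k. h \<cdot>\<^bsub>D\<^esub> \<kappa> i = \<psi> i) \<longleftrightarrow> (\<forall>i < n. h \<cdot>\<^bsub>D\<^esub> \<kappa> i = \<phi> i)" if h: "h \<in> hom D c v" for h
      proof
        assume "\<forall>i < n + k. h \<cdot>\<^bsub>D\<^esub> \<kappa> i = \<psi> i"
        then show "\<forall>i < n. h \<cdot>\<^bsub>D\<^esub> \<kappa> i = \<phi> i" by (simp add: \<psi>_def)
      next
        assume A: "\<forall>i < n. h \<cdot>\<^bsub>D\<^esub> \<kappa> i = \<phi> i"
        show "\<forall>i < n + k. h \<cdot>\<^bsub>D\<^esub> \<kappa> i = \<psi> i"
        proof (intro allI impI)
          fix i assume i: "i < n + k"
          show "h \<cdot>\<^bsub>D\<^esub> \<kappa> i = \<psi> i"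
          proof (cases "i < n")
            case False
            define j where "j = i - n"
            have j: "i = n + j" "j < k" using False i by (simp_all add: j_def)
            have "h \<cdot>\<^bsub>D\<^esub> \<kappa> i = (h \<cdot>\<^bsub>D\<^esub> \<kappa> (l j)) \<cdot>\<^bsub>D\<^esub> f j"
              using cmp_assoc[OF f[OF j(2)] \<kappa>v h] lr[OF j(2)] legl[OF j(2)] j by simp
            then show ?thesis using A lr[OF j(2)] j by (simp add: \<psi>_def)
          qed (use A in \<open>simp add: \<psi>_def\<close>)
        qed
      qed
      with * show ?thesis by (metis (no_types, lifting))
    qed
    have GS: "?G h \<in> S v" if h: "h \<in> hom D c v" for h
      unfolding S
    proof (intro conjI allI impI)
      show "?G h \<in> PiE {..<n} (\<lambda>i. hom D (d i) v)"
        using cmp_hom[OF \<kappa>v h] by auto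
      fix j assume j: "j < k"
      show "?G h (l j) \<cdot>\<^bsub>D\<^esub> f j = ?G h (r j) \<cdot>\<^bsub>D\<^esub> g j"
        using cmp_assoc[OF f[OF j] \<kappa>v h] cmp_assoc[OF g[OF j] \<kappa>v h] lr[OF j] legl[OF j] legr[OF j]
        by simp
    qed
    have "bij_betw ?G (hom D c v) (S v)"
    proof (rule bij_betw_imageI)
      show "inj_on ?G (hom D c v)"
      proof (rule inj_onI)
        fix h h' assume hh: "h \<in> hom D c v" "h' \<in> hom D c v" "?G h = ?G h'"
        have "h' \<cdot>\<^bsub>D\<^esub> \<kappa> i = ?G h i" "h \<cdot>\<^bsub>D\<^esub> \<kappa> i = ?G h i" if "i < n" for i
          using fun_cong[OF hh(3), of i] that by simp_all
        with ex1[OF GS[OF hh(1)]] hh(1,2) show "h = h'" by blast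
      qed
      show "?G ` hom D c v = S v"
      proof (intro equalityI subsetI)
        fix \<phi> assume \<phi>: "\<phi> \<in> S v"
        obtain h where h: "h \<in> hom D c v" "\<forall>i < n. h \<cdot>\<^bsub>D\<^esub> \<kappa> i = \<phi> i"
          using ex1[OF \<phi>] by blast
        have "\<phi> \<in> extensional {..<n}" using \<phi> by (auto simp: S PiE_def)
        then have "\<phi> = ?G h" using h(2) by (intro extensionalityI[of _ "{..<n}"]) auto
        with h(1) show "\<phi> \<in> ?G ` hom D c v" by blast
      qed (use GS in auto)
    qed
    then show ?thesis unfolding eqpoll_def by blast
  qed
  with cC show ?thesis unfolding S_def by blast
qed

text \<open>Finite shapes are drawn from \<open>nat\<close>, so the system is moved along
  enumerations \<open>p\<close> of \<open>X\<close> and \<open>q\<close> of \<open>E\<close>;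
  reindexing is a bijection between the two solution sets. The common source of the two arrows in an
  equation is recorded as \<open>src D f\<close>.\<close>

lemma solutions_representable:
  fixes D :: "('o, 'm) cat"
  assumes cat: "category D" and CD: "C \<subseteq> obj D"
    and colim: "has_finite_colimits (full_subcat D C)"
    and pres: "inclusion_preserves_finite_colimits D C"
    and fin: "finite X" "finite E"
    and d: "\<And>x. x \<in> X \<Longrightarrow> d x \<in> C"
    and E: "\<And>x f y g. (x, f, y, g) \<in> E \<Longrightarrow> x \<in> X \<and> y \<in> X \<and> src D f \<in> C \<and>
      f \<in> hom D (src D f) (d x) \<and> g \<in> hom D (src D f) (d y)"
  shows "\<exists>c \<in> C. \<forall>v \<in> obj D. hom D c v \<approx> solutions D X d E v"
proof -
  obtain p where p: "bij_betw p {..<card X} X"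
    using ex_bij_betw_nat_finite[OF fin(1)] by (auto simp: atLeast0LessThan)
  obtain q where q: "bij_betw q {..<card E} E"
    using ex_bij_betw_nat_finite[OF fin(2)] by (auto simp: atLeast0LessThan)
  define ix where "ix = inv_into {..<card X} p"
  have ix: "ix x < card X" "p (ix x) = x" if "x \<in> X" for x
    using p that inv_into_into[of x p "{..<card X}"] unfolding ix_def bij_betw_def
    by (auto intro: f_inv_into_f)
  have ix_p: "ix (p i) = i" if "i < card X" for i
    using p that unfolding ix_def bij_betw_def by simp
  have pX: "p i \<in> X" if "i < card X" for i using p that by (auto simp: bij_betw_def)
  define l r f g where "l j = ix (fst (q j))" and "r j = ix (fst (snd (snd (q j))))"
    and "f j = fst (snd (q j))" and "g j = snd (snd (snd (q j)))" for j
  let ?E = "(\<lambda>j. (l j, f j, r j, g j)) ` {..<card E}"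
  have qE: "(fst (q j), f j, fst (snd (snd (q j))), g j) \<in> E" if "j < card E" for j
    using q that by (auto simp: bij_betw_def f_def g_def)
  have "\<exists>c \<in> C. \<forall>v \<in> obj D. hom D c v \<approx> solutions D {..<card X} (\<lambda>i. d (p i)) ?E v"
  proof (rule solutions_representable_nat[where e = "\<lambda>j. src D (f j)", OF cat CD colim pres])
    fix j assume "j < card E"
    note Ej = E[OF qE[OF this]]
    show "src D (f j) \<in> C" "l j < card X \<and> r j < card X"
      "f j \<in> hom D (src D (f j)) (d (p (l j)))" "g j \<in> hom D (src D (f j)) (d (p (r j)))"
      using Ej ix by (simp_all add: l_def r_def)
  qed (use d pX in blast)
  then obtain c where c: "c \<in> C" "\<And>v. v \<in> obj D \<Longrightarrow> hom D c v \<approx> solutions D {..<card X} (\<lambda>i. d (p i)) ?E v"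
    by blast
  have Eall: "(\<forall>(x, f, y, g) \<in> E. P x f y g) \<longleftrightarrow>
    (\<forall>j < card E. P (fst (q j)) (f j) (fst (snd (snd (q j)))) (g j))" for P
  proof -
    have "q j \<in> E" if "j < card E" for j using bij_betwE[OF q] that by simp
    moreover have "\<exists>j < card E. t = q j" if "t \<in> E" for t
      using bij_betw_imp_surj_on[OF q] that by (metis imageE lessThan_iff)
    ultimately have "(\<forall>t \<in> E. R t) \<longleftrightarrow> (\<forall>j < card E. R (q j))" for R by metis
    then show ?thesis by (simp only: f_def g_def case_prod_beta)
  qed
  have "solutions D {..<card X} (\<lambda>i. d (p i)) ?E v \<approx> solutions D X d E v" for v
  proof -
    let ?G = "\<lambda>\<phi>. \<lambda>x \<in> X. \<phi> (ix x)" and ?H = "\<lambda>\<phi>. \<lambda>i \<in> {..<card X}. \<phi> (p i)"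
    have "bij_betw ?G (solutions D {..<card X} (\<lambda>i. d (p i)) ?E v) (solutions D X d E v)"
    proof (rule bij_betwI[where g = ?H])
      show "?G \<in> solutions D {..<card X} (\<lambda>i. d (p i)) ?E v \<rightarrow> solutions D X d E v"
      proof (rule funcsetI)
        fix \<phi> assume \<phi>: "\<phi> \<in> solutions D {..<card X} (\<lambda>i. d (p i)) ?E v"
        have "?G \<phi> \<in> PiE X (\<lambda>x. hom D (d x) v)"
          unfolding restrict_PiE_iff
        proof
          fix x assume x: "x \<in> X"
          have "\<phi> i \<in> hom D (d (p i)) v" if "i < card X" for i
            using \<phi> that by (simp add: solutions_def PiE_iff)
          from this[OF ix(1)[OF x]] show "\<phi> (ix x) \<in> hom D (d x) v"
            by (simp add: ix(2)[OF x])
        qed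
        moreover have "\<forall>(x, f, y, g) \<in> E. ?G \<phi> x \<cdot>\<^bsub>D\<^esub> f = ?G \<phi> y \<cdot>\<^bsub>D\<^esub> g"
          unfolding Eall using \<phi> E[OF qE] by (auto simp: solutions_def l_def r_def)
        ultimately show "?G \<phi> \<in> solutions D X d E v" by (simp only: solutions_def mem_Collect_eq)
      qed
      show "?H \<in> solutions D X d E v \<rightarrow> solutions D {..<card X} (\<lambda>i. d (p i)) ?E v"
      proof (rule funcsetI)
        fix \<phi> assume \<phi>: "\<phi> \<in> solutions D X d E v"
        have "?H \<phi> \<in> PiE {..<card X} (\<lambda>i. hom D (d (p i)) v)"
          using \<phi> pX unfolding restrict_PiE_iff by (auto simp: solutions_def)
        moreover have "\<forall>j < card E. ?H \<phi> (l j) \<cdot>\<^bsub>D\<^esub> f j = ?H \<phi> (r j) \<cdot>\<^bsub>D\<^esub> g j"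
          using \<phi> E[OF qE] unfolding solutions_def mem_Collect_eq Eall by (simp add: l_def r_def ix)
        ultimately show "?H \<phi> \<in> solutions D {..<card X} (\<lambda>i. d (p i)) ?E v"
          by (auto simp: solutions_def)
      qed
      show "?H (?G \<phi>) = \<phi>" if "\<phi> \<in> solutions D {..<card X} (\<lambda>i. d (p i)) ?E v" for \<phi>
        using that by (intro extensionalityI[of _ "{..<card X}"])
          (auto simp: solutions_def PiE_def pX ix_p)
      show "?G (?H \<phi>) = \<phi>" if "\<phi> \<in> solutions D X d E v" for \<phi>
        using that by (intro extensionalityI[of _ X]) (auto simp: solutions_def PiE_def ix)
    qed
    then show ?thesis unfolding eqpoll_def by blast
  qed
  with c show ?thesis by (blast intro: eqpoll_trans)
qed

section \<open>Natural injective families between hom-sets\<close>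

lemma obj_slice: "obj (slice D C a) = {x \<in> arr D. src D x \<in> C \<and> trg D x = a}"
  by (simp add: slice_def Let_def)

lemma arr_slice: "(x, g, y) \<in> arr (slice D C a) \<longleftrightarrow>
    x \<in> obj (slice D C a) \<and> y \<in> obj (slice D C a) \<and> g \<in> hom D (src D x) (src D y) \<and> y \<cdot>\<^bsub>D\<^esub> g = x"
  by (simp add: slice_def Let_def)

text \<open>Since an arrow \<open>(x, g, y)\<close> of the slice has x = y \<cdot> g, the last
  condition is naturality: a cocone is a natural family of maps from hom(c, a) to hom(c, v), for c
  in \<open>C\<close>.\<close>

lemma is_cocone_slice_forget: "is_cocone (slice D C a) D (slice_forget D) v \<phi> \<longleftrightarrow>
    v \<in> obj D \<and> (\<forall>x \<in> obj (slice D C a). \<phi> x \<in> hom D (src D x) v) \<and>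
    (\<forall>(x, g, y) \<in> arr (slice D C a). \<phi> y \<cdot>\<^bsub>D\<^esub> g = \<phi> x)"
  by (fastforce simp: is_cocone_def slice_forget_def slice_def Let_def)

text \<open>For each \<open>P\<close> \<subseteq> \<open>N\<close>, the equations in
  \<open>E\<close> together with the equalities in \<open>P\<close> form a system represented by
  some \<open>c\<close> in \<open>C\<close>, so it has equally many solutions in \<open>a\<close>
  and in \<open>b\<close>. By inclusion-exclusion the same holds for the solutions of
  \<open>E\<close> violating every equality in \<open>N\<close>, and \<open>a\<close> has such a
  solution.\<close>

lemma finite_satisfiable_if_eqpoll:
  fixes D :: "('o, 'm) cat"
  assumes cat: "category D" and CD: "C \<subseteq> obj D"
    and colim: "has_finite_colimits (full_subcat D C)"
    and pres: "inclusion_preserves_finite_colimits D C"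
    and a: "a \<in> obj D" "finite_type D C a" and b: "b \<in> obj D"
    and eq: "\<And>c. c \<in> C \<Longrightarrow> hom D c a \<approx> hom D c b"
    and E: "finite E" "E \<subseteq> arr (slice D C a)"
    and N: "finite N" "\<And>x y. (x, y) \<in> N \<Longrightarrow> x \<in> obj (slice D C a) \<and> y \<in> obj (slice D C a) \<and> src D x = src D y \<and> x \<noteq> y"
  shows "\<exists>\<phi> \<in> PiE (obj (slice D C a)) (\<lambda>x. hom D (src D x) b).
    (\<forall>(x, g, y) \<in> E. \<phi> y \<cdot>\<^bsub>D\<^esub> g = \<phi> x) \<and> (\<forall>(x, y) \<in> N. \<phi> x \<noteq> \<phi> y)"
proof -
  interpret category D by fact
  let ?A = "obj (slice D C a)"
  \<comment> \<open>Only the finitely many arrows mentioned in \<open>E\<close> or \<open>N\<close>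
    become unknowns.\<close>
  define X where "X = (\<lambda>(x, g, y). x) ` E \<union> (\<lambda>(x, g, y). y) ` E \<union> fst ` N \<union> snd ` N"
  have X: "finite X" using E(1) N(1) by (simp add: X_def)
  have EX: "x \<in> X \<and> y \<in> X \<and> g \<in> hom D (src D x) (src D y) \<and> y \<cdot>\<^bsub>D\<^esub> g = x" if "(x, g, y) \<in> E" for x g y
  proof -
    from that have "x \<in> X" "y \<in> X" unfolding X_def by force+
    with that E(2) arr_slice[of x g y D C a] show ?thesis by blast
  qed
  have NX: "x \<in> X \<and> y \<in> X" if "(x, y) \<in> N" for x y
    using that unfolding X_def by force
  have XA: "X \<subseteq> ?A" using E(2) N(2) unfolding X_def by (force simp: arr_slice)
  have A: "x \<in> hom D (src D x) a" "src D x \<in> C" if "x \<in> ?A" for x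
    using that by (auto simp: obj_slice hom_def)
  \<comment> \<open>Identities pad the equations to the two-sided form: naturality becomes \<phi> y
    \<cdot> g = \<phi> x \<cdot> id, and the equality of two unknowns \<phi> x \<cdot> id = \<phi> y
    \<cdot> id.\<close>
  let ?E = "\<lambda>P. (\<lambda>(x, g, y). (y, g, x, ident D (src D x))) ` E \<union>
    (\<lambda>(x, y). (x, ident D (src D x), y, ident D (src D x))) ` P"
  let ?S = "\<lambda>P. solutions D X (src D) (?E P)"
  let ?U = "\<lambda>v. {\<phi> \<in> PiE X (\<lambda>x. hom D (src D x) v). \<forall>(x, g, y) \<in> E. \<phi> y \<cdot>\<^bsub>D\<^esub> g = \<phi> x}"
  have S: "?S P v = {\<phi> \<in> ?U v. \<forall>p \<in> P. \<phi> (fst p) = \<phi> (snd p)}" if P: "P \<subseteq> N" for P v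
  proof -
    have 1: "\<phi> x \<cdot>\<^bsub>D\<^esub> ident D (src D x) = \<phi> x" if "\<phi> \<in> PiE X (\<lambda>x. hom D (src D x) v)" "x \<in> X" for \<phi> x
      by (rule cmp_ident) (use that in auto)
    have 2: "(\<phi> x \<cdot>\<^bsub>D\<^esub> ident D (src D x) = \<phi> y \<cdot>\<^bsub>D\<^esub> ident D (src D x)) \<longleftrightarrow> \<phi> x = \<phi> y"
      if "\<phi> \<in> PiE X (\<lambda>x. hom D (src D x) v)" "(x, y) \<in> P" for \<phi> x y
      using 1[OF that(1)] NX[of x y] N(2)[of x y] that P by (metis subsetD)
    show ?thesis
      unfolding solutions_def using 1 2 EX by (fastforce simp: ball_Un)
  qed
  have finU: "finite (?U v)" if "finite_type D C v" for v
  proof -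
    have "finite (PiE X (\<lambda>x. hom D (src D x) v))"
      by (rule finite_PiE[OF X]) (use that A XA in \<open>auto simp: finite_type_def\<close>)
    then show ?thesis by simp
  qed
  have bfin: "finite_type D C b"
    using a(2) eq eqpoll_finite_iff unfolding finite_type_def by blast
  have card: "card {\<phi> \<in> ?U a. \<forall>p \<in> P. \<phi> (fst p) = \<phi> (snd p)} = card {\<phi> \<in> ?U b. \<forall>p \<in> P. \<phi> (fst p) = \<phi> (snd p)}"
    if P: "P \<subseteq> N" for P
  proof -
    have "\<exists>c \<in> C. \<forall>v \<in> obj D. hom D c v \<approx> ?S P v"
    proof (rule solutions_representable[OF cat CD colim pres X])
      show "finite (?E P)" using E(1) N(1) P by (auto intro: finite_subset)
      show "src D x \<in> C" if "x \<in> X" for x using that XA A by blast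
      fix x f y g assume "(x, f, y, g) \<in> ?E P"
      then consider "(y, f, x) \<in> E" "g = ident D (src D y)"
        | "(x, y) \<in> N" "f = ident D (src D x)" "g = ident D (src D x)" using P by auto
      then show "x \<in> X \<and> y \<in> X \<and> src D f \<in> C \<and>
        f \<in> hom D (src D f) (src D x) \<and> g \<in> hom D (src D f) (src D y)"
      proof cases
        case 1
        have yC: "src D y \<in> C" using EX[OF 1(1)] XA A by blast
        have "src D f = src D y" using EX[OF 1(1)] by (simp add: hom_def)
        then show ?thesis using EX[OF 1(1)] yC CD ident_hom[of "src D y"] 1(2) by auto
      next
        case 2
        have xC: "src D x \<in> C" using NX[OF 2(1)] XA A by blast
        have i: "ident D (src D x) \<in> hom D (src D x) (src D x)" using xC CD ident_hom by blast
        then have "src D (ident D (src D x)) = src D x" by (simp add: hom_def)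
        then show ?thesis using NX[OF 2(1)] N(2)[OF 2(1)] i xC 2 by simp
      qed
    qed
    then obtain c where c: "c \<in> C" "hom D c a \<approx> ?S P a" "hom D c b \<approx> ?S P b" using a(1) b by blast
    then have "?S P a \<approx> ?S P b" using eq[OF c(1)] by (meson eqpoll_sym eqpoll_trans)
    moreover have "finite (?S P a)" "finite (?S P b)"
      unfolding S[OF P] using finU[OF a(2)] finU[OF bfin] by (auto intro: rev_finite_subset)
    ultimately have "card (?S P a) = card (?S P b)" using eqpoll_iff_card by blast
    then show ?thesis unfolding S[OF P] .
  qed
  define W where "W v = {\<phi> \<in> ?U v. \<forall>p \<in> N. \<not> \<phi> (fst p) = \<phi> (snd p)}" for v
  have "card (W a) = card (W b)"
    unfolding W_def by (rule card_none_eq_if_card_all_eq[OF N(1) finU[OF a(2)] finU[OF bfin] card])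
  \<comment> \<open>The tautological solution: each unknown is sent to the arrow that names it.
    Pairs in \<open>N\<close> have distinct entries, so every equality in \<open>N\<close>
    fails.\<close>
  moreover have "(\<lambda>x \<in> X. x) \<in> W a"
  proof -
    have "(\<lambda>x \<in> X. x) \<in> PiE X (\<lambda>x. hom D (src D x) a)" using XA A by auto
    moreover have "\<forall>(x, g, y) \<in> E. (\<lambda>x \<in> X. x) y \<cdot>\<^bsub>D\<^esub> g = (\<lambda>x \<in> X. x) x" using EX by auto
    moreover have "\<forall>p \<in> N. \<not> (\<lambda>x \<in> X. x) (fst p) = (\<lambda>x \<in> X. x) (snd p)" using NX N(2) by auto
    ultimately show ?thesis unfolding W_def by (intro CollectI conjI)
  qed
  moreover have "finite (W a)"
    unfolding W_def by (rule finite_subset[OF Collect_subset finU[OF a(2)]])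
  ultimately have "card (W b) \<noteq> 0" by (metis card_0_eq empty_iff)
  then obtain \<phi> where "\<phi> \<in> W b" by fastforce
  then have \<phi>: "\<phi> \<in> PiE X (\<lambda>x. hom D (src D x) b)" "\<forall>(x, g, y) \<in> E. \<phi> y \<cdot>\<^bsub>D\<^esub> g = \<phi> x"
    "\<forall>p \<in> N. \<phi> (fst p) \<noteq> \<phi> (snd p)" by (simp_all add: W_def)
  \<comment> \<open>Values outside \<open>X\<close> are arbitrary, but some value must exist:
    hom(src x, a) contains \<open>x\<close>, so the equinumerous hom(src x, b) is nonempty.\<close>
  have "\<exists>z. z \<in> hom D (src D x) b" if "x \<in> ?A" for x
    using A[OF that] eq[of "src D x"] by (metis all_not_in_conv eqpoll_empty_iff_empty eqpoll_sym)
  then obtain w where w: "w x \<in> hom D (src D x) b" if "x \<in> ?A" for x by metis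
  let ?\<psi> = "\<lambda>x \<in> ?A. if x \<in> X then \<phi> x else w x"
  have \<psi>: "?\<psi> x = \<phi> x" if "x \<in> X" for x using that XA by auto
  show ?thesis
  proof (intro bexI conjI)
    show "?\<psi> \<in> PiE ?A (\<lambda>x. hom D (src D x) b)" using w \<phi>(1) by auto
    show "\<forall>(x, g, y) \<in> E. ?\<psi> y \<cdot>\<^bsub>D\<^esub> g = ?\<psi> x" using \<phi>(2) EX \<psi> by fastforce
    show "\<forall>(x, y) \<in> N. ?\<psi> x \<noteq> ?\<psi> y" using \<phi>(3) NX \<psi> by fastforce
  qed
qed

text \<open>Compactness combines the finite parts into one family. Each unknown has finitely many
  possible values because hom(c, b) is equinumerous with the finite set hom(c, a).\<close>

lemma natural_injection_if_eqpoll: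
  fixes D :: "('o, 'm) cat"
  assumes cat: "category D" and CD: "C \<subseteq> obj D"
    and colim: "has_finite_colimits (full_subcat D C)"
    and pres: "inclusion_preserves_finite_colimits D C"
    and a: "a \<in> obj D" "finite_type D C a" and b: "b \<in> obj D"
    and eq: "\<And>c. c \<in> C \<Longrightarrow> hom D c a \<approx> hom D c b"
  shows "\<exists>\<phi>. is_cocone (slice D C a) D (slice_forget D) b \<phi> \<and> (\<forall>c \<in> C. inj_on \<phi> (hom D c a))"
proof -
  let ?A = "obj (slice D C a)" and ?Ar = "arr (slice D C a)"
  let ?N = "{(x, y). x \<in> ?A \<and> y \<in> ?A \<and> src D x = src D y \<and> x \<noteq> y}"
  \<comment> \<open>Constraints are indexed by a disjoint sum: \<open>Inl\<close> carries naturality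
    at an arrow of the slice, \<open>Inr\<close> the inequation for two distinct arrows with the
    same source.\<close>
  let ?x = "case_sum (\<lambda>(x, g, y). x) fst" and ?y = "case_sum (\<lambda>(x, g, y). y) snd"
  let ?R = "case_sum (\<lambda>(x, g, y). {(u, v). v \<cdot>\<^bsub>D\<^esub> g = u}) (\<lambda>_. {(u, v). u \<noteq> v})"
  have "\<exists>\<phi> \<in> PiE ?A (\<lambda>x. hom D (src D x) b). \<forall>i \<in> ?Ar <+> ?N. (\<phi> (?x i), \<phi> (?y i)) \<in> ?R i"
  proof (rule finite_selection_compactness)
    fix x assume "x \<in> ?A"
    then have "src D x \<in> C" by (simp add: obj_slice)
    then show "finite (hom D (src D x) b)"
      using eq a(2) eqpoll_finite_iff unfolding finite_type_def by blast
  next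
    fix i assume "i \<in> ?Ar <+> ?N"
    then show "?x i \<in> ?A \<and> ?y i \<in> ?A" by (auto simp: arr_slice)
  next
    fix K assume K: "finite K" "K \<subseteq> ?Ar <+> ?N"
    have "\<exists>\<phi> \<in> PiE ?A (\<lambda>x. hom D (src D x) b).
      (\<forall>(x, g, y) \<in> Inl -` K. \<phi> y \<cdot>\<^bsub>D\<^esub> g = \<phi> x) \<and> (\<forall>(x, y) \<in> Inr -` K. \<phi> x \<noteq> \<phi> y)"
      by (rule finite_satisfiable_if_eqpoll[OF cat CD colim pres a b eq])
        (use K in \<open>auto intro!: finite_vimageI\<close>)
    then obtain \<phi> where \<phi>: "\<phi> \<in> PiE ?A (\<lambda>x. hom D (src D x) b)"
      "\<forall>(x, g, y) \<in> Inl -` K. \<phi> y \<cdot>\<^bsub>D\<^esub> g = \<phi> x" "\<forall>(x, y) \<in> Inr -` K. \<phi> x \<noteq> \<phi> y" by blast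
    have "(\<phi> (?x i), \<phi> (?y i)) \<in> ?R i" if "i \<in> K" for i
      using that \<phi>(2,3) by (cases i) fastforce+
    with \<phi>(1) show "\<exists>\<phi> \<in> PiE ?A (\<lambda>x. hom D (src D x) b). \<forall>i \<in> K. (\<phi> (?x i), \<phi> (?y i)) \<in> ?R i" by blast
  qed
  then obtain \<phi> where \<phi>: "\<phi> \<in> PiE ?A (\<lambda>x. hom D (src D x) b)"
    and R: "\<And>i. i \<in> ?Ar <+> ?N \<Longrightarrow> (\<phi> (?x i), \<phi> (?y i)) \<in> ?R i" by blast
  have "\<phi> y \<cdot>\<^bsub>D\<^esub> g = \<phi> x" if "(x, g, y) \<in> ?Ar" for x g y
    using R[OF InlI[OF that]] by simp
  then have "is_cocone (slice D C a) D (slice_forget D) b \<phi>"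
    using \<phi> b unfolding is_cocone_slice_forget by auto
  moreover have "inj_on \<phi> (hom D c a)" if "c \<in> C" for c
  proof (rule inj_onI, rule ccontr)
    fix x y assume xy: "x \<in> hom D c a" "y \<in> hom D c a" "\<phi> x = \<phi> y" "x \<noteq> y"
    then have "(x, y) \<in> ?N" using that by (simp add: obj_slice hom_def)
    from R[OF InrI[OF this]] xy(3) show False by simp
  qed
  ultimately show ?thesis by blast
qed

section \<open>Density: detecting equality and invertibility of arrows by arrows out of
  \<open>C\<close>\<close>

text \<open>Composition with \<open>f\<close> and with \<open>g\<close> gives the same cocone on the
  slice over \<open>a\<close>, and the mediating arrow from the colimit \<open>a\<close> is
  unique.\<close>

lemma dense_in_arrow_eqI:
  assumes "dense_in D C" "category D" "a \<in> obj D" "f \<in> hom D a v" "g \<in> hom D a v"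
    and eq: "\<And>c x. c \<in> C \<Longrightarrow> x \<in> hom D c a \<Longrightarrow> f \<cdot>\<^bsub>D\<^esub> x = g \<cdot>\<^bsub>D\<^esub> x"
  shows "f = g"
proof -
  interpret category D by fact
  have v: "v \<in> obj D" using assms(4) trg_obj by (auto simp: hom_def)
  have A: "x \<in> hom D (src D x) a" "src D x \<in> C" if "x \<in> obj (slice D C a)" for x
    using that by (auto simp: obj_slice hom_def)
  have "is_cocone (slice D C a) D (slice_forget D) v (\<lambda>x. f \<cdot>\<^bsub>D\<^esub> x)"
    unfolding is_cocone_slice_forget
  proof (intro conjI ballI v; clarify?)
    fix x assume "x \<in> obj (slice D C a)"
    then show "f \<cdot>\<^bsub>D\<^esub> x \<in> hom D (src D x) v" using A assms(4) cmp_hom by blast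
  next
    fix x g y assume "(x, g, y) \<in> arr (slice D C a)"
    then show "f \<cdot>\<^bsub>D\<^esub> y \<cdot>\<^bsub>D\<^esub> g = f \<cdot>\<^bsub>D\<^esub> x"
      using A cmp_assoc assms(4) unfolding arr_slice by metis
  qed
  then have "\<exists>!h. h \<in> hom D a v \<and> (\<forall>x \<in> obj (slice D C a). h \<cdot>\<^bsub>D\<^esub> x = f \<cdot>\<^bsub>D\<^esub> x)"
    using assms(1,3) unfolding dense_in_def is_colimit_def by blast
  moreover have "\<forall>x \<in> obj (slice D C a). g \<cdot>\<^bsub>D\<^esub> x = f \<cdot>\<^bsub>D\<^esub> x" using eq A by metis
  ultimately show ?thesis using assms(4,5) by blast
qed

text \<open>The pointwise inverse of composition with \<open>h\<close> is again natural, so density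
  at \<open>b\<close> realises it as composition with some \<open>g\<close> from \<open>b\<close> to
  \<open>a\<close>. Both composites of \<open>g\<close> and \<open>h\<close> act as identities on
  arrows out of \<open>C\<close>, hence are identities.\<close>

lemma dense_in_is_isoI:
  assumes dense: "dense_in D C" and cat: "category D" and a: "a \<in> obj D" and b: "b \<in> obj D"
    and h: "h \<in> hom D a b"
    and bij: "\<And>c. c \<in> C \<Longrightarrow> bij_betw (\<lambda>x. h \<cdot>\<^bsub>D\<^esub> x) (hom D c a) (hom D c b)"
  shows "is_iso D h"
proof -
  interpret category D by fact
  define \<psi> where "\<psi> y = (THE x. x \<in> hom D (src D y) a \<and> h \<cdot>\<^bsub>D\<^esub> x = y)" for y
  have inj: "x = x'" if "c \<in> C" "x \<in> hom D c a" "x' \<in> hom D c a" "h \<cdot>\<^bsub>D\<^esub> x = h \<cdot>\<^bsub>D\<^esub> x'" for c x x'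
    using inj_onD[OF bij_betw_imp_inj_on[OF bij[OF that(1)]] that(4,2,3)] .
  have \<psi>: "\<psi> y \<in> hom D c a" "h \<cdot>\<^bsub>D\<^esub> \<psi> y = y" if "y \<in> hom D c b" "c \<in> C" for y c
  proof -
    have "y \<in> (\<lambda>x. h \<cdot>\<^bsub>D\<^esub> x) ` hom D c a"
      using bij[OF that(2)] that(1) by (simp add: bij_betw_def)
    then obtain x where x: "x \<in> hom D c a" "h \<cdot>\<^bsub>D\<^esub> x = y" by blast
    have "src D y = c" using that by (simp add: hom_def)
    then have "\<psi> y = x"
      unfolding \<psi>_def using x inj[OF that(2)] by (intro the_equality) auto
    with x show "\<psi> y \<in> hom D c a" "h \<cdot>\<^bsub>D\<^esub> \<psi> y = y" by simp_all
  qed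
  have B: "y \<in> hom D (src D y) b" "src D y \<in> C" if "y \<in> obj (slice D C b)" for y
    using that by (auto simp: obj_slice hom_def)
  have "is_cocone (slice D C b) D (slice_forget D) a \<psi>"
    unfolding is_cocone_slice_forget
  proof (intro conjI ballI a; clarify?)
    fix y assume "y \<in> obj (slice D C b)"
    then show "\<psi> y \<in> hom D (src D y) a" using \<psi> B by blast
  next
    fix y g z assume "(y, g, z) \<in> arr (slice D C b)"
    then have yz: "y \<in> obj (slice D C b)" "z \<in> obj (slice D C b)" "g \<in> hom D (src D y) (src D z)"
      "z \<cdot>\<^bsub>D\<^esub> g = y" by (simp_all add: arr_slice)
    note y = \<psi>[OF B[OF yz(1)]] and z = \<psi>[OF B[OF yz(2)]]
    \<comment> \<open>Composition with \<open>h\<close> sends both sides to \<open>y\<close>, and it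
      is injective on arrows out of \<open>C\<close>.\<close>
    show "\<psi> z \<cdot>\<^bsub>D\<^esub> g = \<psi> y"
      by (rule inj[OF B(2)[OF yz(1)] cmp_hom[OF yz(3) z(1)] y(1)])
        (use cmp_assoc[OF yz(3) z(1) h] y z yz(4) in simp)
  qed
  then obtain g where g: "g \<in> hom D b a" "\<forall>y \<in> obj (slice D C b). g \<cdot>\<^bsub>D\<^esub> y = \<psi> y"
    using dense b unfolding dense_in_def is_colimit_def by blast
  have gy: "g \<cdot>\<^bsub>D\<^esub> y = \<psi> y" if "y \<in> hom D c b" "c \<in> C" for c y
    using g(2) that by (simp add: obj_slice hom_def)
  have hg: "h \<cdot>\<^bsub>D\<^esub> g = ident D b"
  proof (rule dense_in_arrow_eqI[OF dense cat b cmp_hom[OF g(1) h] ident_hom[OF b]])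
    fix c y assume "c \<in> C" "y \<in> hom D c b"
    then show "h \<cdot>\<^bsub>D\<^esub> g \<cdot>\<^bsub>D\<^esub> y = ident D b \<cdot>\<^bsub>D\<^esub> y"
      using cmp_assoc[OF _ g(1) h] gy \<psi>(2) ident_cmp by metis
  qed
  have gh: "g \<cdot>\<^bsub>D\<^esub> h = ident D a"
  proof (rule dense_in_arrow_eqI[OF dense cat a cmp_hom[OF h g(1)] ident_hom[OF a]])
    fix c x assume c: "c \<in> C" and x: "x \<in> hom D c a"
    have hx: "h \<cdot>\<^bsub>D\<^esub> x \<in> hom D c b" by (rule cmp_hom[OF x h])
    have "\<psi> (h \<cdot>\<^bsub>D\<^esub> x) = x" by (rule inj[OF c \<psi>(1)[OF hx c] x \<psi>(2)[OF hx c]])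
    then show "g \<cdot>\<^bsub>D\<^esub> h \<cdot>\<^bsub>D\<^esub> x = ident D a \<cdot>\<^bsub>D\<^esub> x"
      using cmp_assoc[OF x h g(1)] gy[OF hx c] ident_cmp[OF x] by simp
  qed
  from h g(1) gh hg show ?thesis unfolding is_iso_def by (auto simp: hom_def)
qed

section \<open>Isomorphism and the sizes of hom-sets\<close>

lemma hom_eqpoll_if_isomorphic:
  assumes cat: "category D" and iso: "isomorphic D a b"
  shows "hom D c a \<approx> hom D c b"
proof -
  interpret category D by fact
  obtain f g where f: "f \<in> hom D a b" and g: "g \<in> hom D b a"
    and fg: "g \<cdot>\<^bsub>D\<^esub> f = ident D a" "f \<cdot>\<^bsub>D\<^esub> g = ident D b"
    using iso unfolding isomorphic_def is_iso_def by (auto simp: hom_def)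
  have "bij_betw (\<lambda>x. f \<cdot>\<^bsub>D\<^esub> x) (hom D c a) (hom D c b)"
  proof (rule bij_betwI[where g = "\<lambda>y. g \<cdot>\<^bsub>D\<^esub> y"])
    show "g \<cdot>\<^bsub>D\<^esub> (f \<cdot>\<^bsub>D\<^esub> x) = x" if "x \<in> hom D c a" for x
      using cmp_assoc[OF that f g] fg(1) ident_cmp[OF that] by simp
    show "f \<cdot>\<^bsub>D\<^esub> (g \<cdot>\<^bsub>D\<^esub> y) = y" if "y \<in> hom D c b" for y
      using cmp_assoc[OF that g f] fg(2) ident_cmp[OF that] by simp
  qed (use cmp_hom f g in blast)+
  then show ?thesis unfolding eqpoll_def by blast
qed

theorem theorem5p10:
  fixes D :: "('o, 'm) cat"
    and C :: "'o set"
    and Q M :: "'m set"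
    and a b :: 'o
  assumes "category D"
    and "locally_small TYPE('u) D"
    and "well_powered TYPE('u) D"
    and "well_copowered TYPE('u) D"
    and "proper_factorisation_system D Q M"
    and "C \<subseteq> obj D"
    and "dense_in D C"
    and "has_finite_colimits (full_subcat D C)"
    and "inclusion_preserves_finite_colimits D C"
    and "\<And>e m. e \<in> Q \<Longrightarrow> m \<in> M \<Longrightarrow> trg D e = src D m \<Longrightarrow>
           src D e \<in> C \<Longrightarrow> trg D m \<in> C \<Longrightarrow> trg D e \<in> C"
    and "a \<in> obj D" "separable TYPE('u) D C M a" "finite_type D C a"
    and "b \<in> obj D" "separable TYPE('u) D C M b" "finite_type D C b"
  shows "isomorphic D a b \<longleftrightarrow> (\<forall>c \<in> C. hom D c a \<approx> hom D c b)"
proof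
  assume "isomorphic D a b"
  then show "\<forall>c \<in> C. hom D c a \<approx> hom D c b"
    using hom_eqpoll_if_isomorphic[OF assms(1)] by blast
next
  assume eq: "\<forall>c \<in> C. hom D c a \<approx> hom D c b"
  interpret category D by fact
  obtain \<phi> where \<phi>: "is_cocone (slice D C a) D (slice_forget D) b \<phi>" "\<forall>c \<in> C. inj_on \<phi> (hom D c a)"
    using natural_injection_if_eqpoll[OF assms(1,6,8,9,11,13,14)] eq by metis
  \<comment> \<open>Density at \<open>a\<close> turns the natural family into composition with a
    single arrow.\<close>
  then obtain h where h: "h \<in> hom D a b" "\<forall>x \<in> obj (slice D C a). h \<cdot>\<^bsub>D\<^esub> x = \<phi> x"
    using assms(7,11) unfolding dense_in_def is_colimit_def by blast
  have "bij_betw (\<lambda>x. h \<cdot>\<^bsub>D\<^esub> x) (hom D c a) (hom D c b)" if c: "c \<in> C" for c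
  proof -
    have fin: "finite (hom D c a)" "finite (hom D c b)"
      using assms(13,16) c by (simp_all add: finite_type_def)
    have "h \<cdot>\<^bsub>D\<^esub> x = \<phi> x" if "x \<in> hom D c a" for x
      using h(2) that c by (simp add: obj_slice hom_def)
    then have inj: "inj_on (\<lambda>x. h \<cdot>\<^bsub>D\<^esub> x) (hom D c a)"
      using \<phi>(2) c by (simp add: inj_on_def)
    have "card (hom D c a) = card (hom D c b)" using eq c fin eqpoll_iff_card by blast
    moreover have "(\<lambda>x. h \<cdot>\<^bsub>D\<^esub> x) ` hom D c a \<subseteq> hom D c b" using cmp_hom h(1) by blast
    \<comment> \<open>An injection between finite sets of equal size is onto.\<close>
    ultimately have "(\<lambda>x. h \<cdot>\<^bsub>D\<^esub> x) ` hom D c a = hom D c b"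
      using card_subset_eq[OF fin(2)] card_image[OF inj] by simp
    with inj show ?thesis by (simp add: bij_betw_def)
  qed
  then have "is_iso D h" by (rule dense_in_is_isoI[OF assms(7,1,11,14) h(1)])
  with h(1) show "isomorphic D a b" unfolding isomorphic_def by blast
qed

end
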